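(* $\mathrm{QSMS}=\mathrm{QSAS}^{\max}$; that is, the quasi-stratified maximal structures are exactly those quasi-stratified acyclic structures $rs\in\mathrm{QSAS}$ whose only extension in $\mathrm{QSAS}$ is $rs$ itself.
   Context: A structure is a triple $rs=\langle\Delta,\prec,\sqsubset\rangle$ where $\Delta$ is a finite set and $\prec,\sqsubset$ are binary relations over $\Delta$. It is a relational structure if both relations are irreflexive. A structure $rs'=\langle\Delta',\prec',\sqsubset'\rangle$ is an extension of $rs=\langle\Delta,\prec,\sqsubset\rangle$ if $\Delta=\Delta'$, $\prec\subseteq\prec'$ and $\sqsubset\subseteq\sqsubset'$. For a structure $rs=\langle\Delta,\prec,\sqsubset\rangle$, a nonempty $\Phi\subseteq\Delta$ is a csc-subset if the directed graph $\langle\Phi,(\sqsubset\cup\prec)|_{\Phi\times\Phi}\rangle$ is strongly connected. A pre-dominant of $\Phi$ is any $x\in\Phi$ such that there is no $y\in\Phi$ with $x\prec y$ or $y\prec x$. $\mathrm{QSAS}$ is the set of all quasi-stratified acyclic structures, i.e. relational structures in which every csc-subset has at least one pre-dominant. $\mathrm{QSAS}^{\max}$ is the set of all $rs\in\mathrm{QSAS}$ such that the only extension of $rs$ belonging to $\mathrm{QSAS}$ is $rs$. $\mathrm{QSMS}$ is the set of all quasi-stratified maximal structures, i.e. structures $\langle\Delta,\prec,\sqsubset\rangle$ such that for all $x,y,z,t\in\Delta$: (1) $x\not\sqsubset x$; (2) $x\prec y \iff (x\sqsubset y$ and $y\not\sqsubset x)$; (3) $x\neq y \iff (x\prec y$ or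 $y\prec x$ or $(x\sqsubset y$ and $y\sqsubset x))$; (4) if $x\prec y$ and $z\prec t$, then ($x\prec t$ and $z\prec y$) or ($x\prec z$ and $x\prec t$) or ($z\prec x$ and $z\prec y$) or ($t\prec y$ and $z\prec y$) or ($y\prec t$ and $x\prec t$). *)

theory Defs
  imports "Graph_Theory.Digraph_Component" "Graph_Theory.Pair_Digraph"
begin

record 'a structure_triple =
  elems :: "'a set"
  prec :: "('a \<times> 'a) set"
  wprec :: "('a \<times> 'a) set"

abbreviation prec_rel :: "'a \<Rightarrow> 'a structure_triple \<Rightarrow> 'a \<Rightarrow> bool"
    ("(_ \<prec>\<^bsub>_\<^esub> _)" [51, 0, 51] 50) where
  "x \<prec>\<^bsub>rs\<^esub> y \<equiv> (x, y) \<in> prec rs"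

abbreviation wprec_rel :: "'a \<Rightarrow> 'a structure_triple \<Rightarrow> 'a \<Rightarrow> bool"
    ("(_ \<sqsubset>\<^bsub>_\<^esub> _)" [51, 0, 51] 50) where
  "x \<sqsubset>\<^bsub>rs\<^esub> y \<equiv> (x, y) \<in> wprec rs"

definition is_structure :: "'a structure_triple \<Rightarrow> bool" where
  "is_structure rs \<longleftrightarrow>
     finite (elems rs) \<and>
     prec rs \<subseteq> elems rs \<times> elems rs \<and>
     wprec rs \<subseteq> elems rs \<times> elems rs"

definition relational_structure :: "'a structure_triple \<Rightarrow> bool" where
  "relational_structure rs \<longleftrightarrow>
     is_structure rs \<and> irrefl_on (elems rs) (prec rs) \<and> irrefl_on (elems rs) (wprec rs)"

definition extension_of :: "'a structure_triple \<Rightarrow> 'a structure_triple \<Rightarrow> bool" where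
  "extension_of rs' rs \<longleftrightarrow>
     elems rs = elems rs' \<and> prec rs \<subseteq> prec rs' \<and> wprec rs \<subseteq> wprec rs'"

text \<open>The library's \<^const>\<open>strongly_connected\<close> already requires a nonempty vertex set.\<close>

definition csc_subset :: "'a structure_triple \<Rightarrow> 'a set \<Rightarrow> bool" where
  "csc_subset rs \<Phi> \<longleftrightarrow>
     \<Phi> \<noteq> {} \<and> \<Phi> \<subseteq> elems rs \<and>
     strongly_connected
       (with_proj \<lparr> pverts = \<Phi>, parcs = (wprec rs \<union> prec rs) \<inter> \<Phi> \<times> \<Phi> \<rparr>)"

definition pre_dominant :: "'a structure_triple \<Rightarrow> 'a set \<Rightarrow> 'a \<Rightarrow> bool" where
  "pre_dominant rs \<Phi> x \<longleftrightarrow>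
     x \<in> \<Phi> \<and> \<not> (\<exists>y\<in>\<Phi>. x \<prec>\<^bsub>rs\<^esub> y \<or> y \<prec>\<^bsub>rs\<^esub> x)"

definition QSAS :: "'a structure_triple set" where
  "QSAS = {rs. relational_structure rs \<and>
     (\<forall>\<Phi>. csc_subset rs \<Phi> \<longrightarrow> (\<exists>x. pre_dominant rs \<Phi> x))}"

definition QSAS_max :: "'a structure_triple set" where
  "QSAS_max = {rs \<in> QSAS. \<forall>rs' \<in> QSAS. extension_of rs' rs \<longrightarrow> rs' = rs}"

definition QSMS :: "'a structure_triple set" where
  "QSMS = {rs. is_structure rs \<and>
     (\<forall>x\<in>elems rs. \<forall>y\<in>elems rs. \<forall>z\<in>elems rs. \<forall>t\<in>elems rs.
        \<not> x \<sqsubset>\<^bsub>rs\<^esub> x \<and>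
        (x \<prec>\<^bsub>rs\<^esub> y \<longleftrightarrow> x \<sqsubset>\<^bsub>rs\<^esub> y \<and> \<not> y \<sqsubset>\<^bsub>rs\<^esub> x) \<and>
        (x \<noteq> y \<longleftrightarrow> x \<prec>\<^bsub>rs\<^esub> y \<or> y \<prec>\<^bsub>rs\<^esub> x \<or> (x \<sqsubset>\<^bsub>rs\<^esub> y \<and> y \<sqsubset>\<^bsub>rs\<^esub> x)) \<and>
        (x \<prec>\<^bsub>rs\<^esub> y \<and> z \<prec>\<^bsub>rs\<^esub> t \<longrightarrow>
           (x \<prec>\<^bsub>rs\<^esub> t \<and> z \<prec>\<^bsub>rs\<^esub> y) \<or>
           (x \<prec>\<^bsub>rs\<^esub> z \<and> x \<prec>\<^bsub>rs\<^esub> t) \<or>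
           (z \<prec>\<^bsub>rs\<^esub> x \<and> z \<prec>\<^bsub>rs\<^esub> y) \<or>
           (t \<prec>\<^bsub>rs\<^esub> y \<and> z \<prec>\<^bsub>rs\<^esub> y) \<or>
           (y \<prec>\<^bsub>rs\<^esub> t \<and> x \<prec>\<^bsub>rs\<^esub> t)))}"

end

theory Submission
  imports Defs
begin

text \<open>
  A finite order satisfying the four-point condition (4) and having no isolated point splits as
  \<open>A \<union> B\<close> with every element of \<open>A\<close> below every element of \<open>B\<close>. Since \<open>\<sqsubset>\<close> is the complement of
  \<open>\<succ>\<close> in a maximal structure, such a set is never strongly connected; this gives
  \<open>QSMS \<subseteq> QSAS\<close>, and maximality follows from csc-subsets with two elements. Conversely, every
  structure in \<open>QSAS\<close> extends to one in \<open>QSMS\<close>: a strongly connected set is handled by leaving a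
  pre-dominant isolated, any other set by ordering the two sides of a cut.
\<close>

section \<open>Orders satisfying the four-point condition and their splitting\<close>

text \<open>Condition (4) for a bare relation, stated without a carrier. Asymmetry, which (2)
  provides in \<open>QSMS\<close>, is included, so that transitivity follows.\<close>

definition quasi_stratified :: "('a \<times> 'a) set \<Rightarrow> bool" where
  "quasi_stratified P \<longleftrightarrow> asym P \<and>
     (\<forall>x y z t. (x, y) \<in> P \<longrightarrow> (z, t) \<in> P \<longrightarrow>
        (x, t) \<in> P \<and> (z, y) \<in> P \<or>
        (x, z) \<in> P \<and> (x, t) \<in> P \<or>
        (z, x) \<in> P \<and> (z, y) \<in> P \<or>
        (t, y) \<in> P \<and> (z, y) \<in> P \<or>
        (y, t) \<in> P \<and> (x, t) \<in> P)"

lemma quasi_stratified_asym: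
  "quasi_stratified P \<Longrightarrow> (x, y) \<in> P \<Longrightarrow> (y, x) \<notin> P"
  unfolding quasi_stratified_def by (auto dest: asymD)

lemma quasi_stratified_four_points:
  assumes "quasi_stratified P" "(x, y) \<in> P" "(z, t) \<in> P"
  shows "(x, t) \<in> P \<and> (z, y) \<in> P \<or> (x, z) \<in> P \<and> (x, t) \<in> P \<or>
    (z, x) \<in> P \<and> (z, y) \<in> P \<or> (t, y) \<in> P \<and> (z, y) \<in> P \<or> (y, t) \<in> P \<and> (x, t) \<in> P"
  using assms unfolding quasi_stratified_def by blast

text \<open>For two consecutive pairs, every alternative of the four-point condition contains
  \<open>(x, z)\<close> or contradicts asymmetry.\<close>

lemma quasi_stratified_trans:
  assumes "quasi_stratified P" shows "trans P"
proof (rule transI)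
  fix x y z assume "(x, y) \<in> P" "(y, z) \<in> P"
  then show "(x, z) \<in> P"
    using quasi_stratified_four_points[OF assms, of x y y z] quasi_stratified_asym[OF assms] by blast
qed

lemma quasi_stratified_empty: "quasi_stratified {}"
  by (auto simp: quasi_stratified_def asym_on_def)

text \<open>Two pairs both from \<open>P\<close> or both from \<open>Q\<close> are settled by
  hypothesis. In every other case the pairs in \<open>A \<times> B\<close> already supply one of the
  five alternatives.\<close>

lemma quasi_stratified_series:
  assumes "quasi_stratified P" "P \<subseteq> A \<times> A" "quasi_stratified Q" "Q \<subseteq> B \<times> B" "A \<inter> B = {}"
  shows "quasi_stratified (P \<union> Q \<union> A \<times> B)"
proof -
  have "asym (P \<union> Q \<union> A \<times> B)"
    using assms(2,4,5) quasi_stratified_asym[OF assms(1)] quasi_stratified_asym[OF assms(3)]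
    by (intro asymI) blast
  moreover have "(x, t) \<in> R \<and> (z, y) \<in> R \<or> (x, z) \<in> R \<and> (x, t) \<in> R \<or>
      (z, x) \<in> R \<and> (z, y) \<in> R \<or> (t, y) \<in> R \<and> (z, y) \<in> R \<or> (y, t) \<in> R \<and> (x, t) \<in> R"
    if R: "R = P \<union> Q \<union> A \<times> B" and xy: "(x, y) \<in> R" and zt: "(z, t) \<in> R" for R x y z t
  proof -
    have e: "(u, v) \<in> P \<and> u \<in> A \<and> v \<in> A \<or> (u, v) \<in> Q \<and> u \<in> B \<and> v \<in> B \<or> u \<in> A \<and> v \<in> B"
      if "(u, v) \<in> R" for u v
      using that assms(2,4) R by blast
    have AB: "u \<in> A \<Longrightarrow> v \<in> B \<Longrightarrow> (u, v) \<in> R" for u v using R by blast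
    have sub: "(u, v) \<in> P \<Longrightarrow> (u, v) \<in> R" "(u, v) \<in> Q \<Longrightarrow> (u, v) \<in> R" for u v using R by auto
    from e[OF xy] e[OF zt] show ?thesis
      using quasi_stratified_four_points[OF assms(1), of x y z t]
        quasi_stratified_four_points[OF assms(3), of x y z t]
      by (elim disjE conjE) (simp_all add: AB sub, (metis AB sub)+)
  qed
  ultimately show ?thesis unfolding quasi_stratified_def by simp
qed

text \<open>The upper part is the set of successors of a minimal element having as few of them as possible.\<close>

lemma quasi_stratified_split:
  assumes qs: "quasi_stratified P" and "finite \<Phi>" "\<Phi> \<noteq> {}"
    and ni: "\<forall>x\<in>\<Phi>. \<exists>y\<in>\<Phi>. (x, y) \<in> P \<or> (y, x) \<in> P"
  obtains B where "B \<subseteq> \<Phi>" "B \<noteq> {}" "B \<noteq> \<Phi>" "(\<Phi> - B) \<times> B \<subseteq> P"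
proof -
  note asym = quasi_stratified_asym[OF qs]
  note four = quasi_stratified_four_points[OF qs]
  define U where "U x = {y \<in> \<Phi>. (x, y) \<in> P}" for x
  define M where "M = {x \<in> \<Phi>. \<forall>y\<in>\<Phi>. (y, x) \<notin> P}"
  have fU: "finite (U x)" for x using assms(2) by (simp add: U_def)
  have "P\<^sup>+ = P" using quasi_stratified_trans[OF qs] by (rule trancl_id)
  then have "acyclic P" using asym by (auto simp: acyclic_def)
  then have "wf (P \<inter> \<Phi> \<times> \<Phi>)"
    using assms(2) by (intro finite_acyclic_wf) (auto intro: acyclic_subset finite_subset[of _ "\<Phi> \<times> \<Phi>"])
  moreover obtain w where "w \<in> \<Phi>" using assms(3) by blast
  ultimately obtain m where "m \<in> \<Phi>" "\<And>y. (y, m) \<in> P \<inter> \<Phi> \<times> \<Phi> \<Longrightarrow> y \<notin> \<Phi>"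
    by (rule wfE_min) blast
  then have "m \<in> M" unfolding M_def by blast
  then obtain z where z: "z \<in> M" and zmin: "\<And>x. x \<in> M \<Longrightarrow> card (U z) \<le> card (U x)"
    using ex_has_least_nat[of "\<lambda>x. x \<in> M" m "\<lambda>x. card (U x)"] by blast
  have z\<Phi>: "z \<in> \<Phi>" and zbot: "\<And>y. y \<in> \<Phi> \<Longrightarrow> (y, z) \<notin> P" using z by (auto simp: M_def)
  have below: "(a, b) \<in> P" if a: "a \<in> \<Phi>" "a \<notin> U z" and b: "b \<in> U z" for a b
  proof (cases "a \<in> M")
    case False
    \<comment> \<open>The four-point condition is applied to \<open>c\<close> below \<open>a\<close>
      and \<open>z\<close> below \<open>b\<close>. Four alternatives put \<open>a\<close> above
      \<open>z\<close> or \<open>c\<close> below \<open>z\<close>, both excluded; the fifth puts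
      \<open>a\<close> below \<open>b\<close>.\<close>
    then obtain c where c: "c \<in> \<Phi>" "(c, a) \<in> P" using a by (auto simp: M_def)
    then show ?thesis
      using four[of c a z b] a b zbot by (auto simp: U_def)
  next
    case True
    show ?thesis
    proof (rule ccontr)
      assume n: "(a, b) \<notin> P"
      \<comment> \<open>Otherwise the least cardinality of \<open>U z\<close> would force equality,
        although \<open>b\<close> lies only in \<open>U z\<close>.\<close>
      have "\<not> U a \<subseteq> U z"
      proof
        assume "U a \<subseteq> U z"
        then have "U a = U z" using zmin[OF True] fU by (simp add: card_seteq)
        then show False using b n by (auto simp: U_def)
      qed
      then obtain c where "c \<in> \<Phi>" "(a, c) \<in> P" "(z, c) \<notin> P" by (auto simp: U_def)
      \<comment> \<open>Each of the five alternatives contains \<open>(a, b)\<close> or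
        \<open>(z, c)\<close>, and neither is in \<open>P\<close>.\<close>
      then show False using four[of a c z b] b n by (auto simp: U_def)
    qed
  qed
  show thesis
  proof
    show "U z \<subseteq> \<Phi>" by (auto simp: U_def)
    show "U z \<noteq> {}" using ni z\<Phi> zbot by (auto simp: U_def)
    show "U z \<noteq> \<Phi>" using z\<Phi> asym by (auto simp: U_def)
    show "(\<Phi> - U z) \<times> U z \<subseteq> P" using below by auto
  qed
qed

section \<open>Strong connectivity by cuts\<close>

text \<open>A set without outgoing edges contains all that is reachable from its members, and the
  set reachable from a vertex has no outgoing edges. This replaces paths by cuts, the form in which
  splittings of orders can be used.\<close>

lemma csc_subset_iff_no_cut:
  "csc_subset rs \<Phi> \<longleftrightarrow> \<Phi> \<noteq> {} \<and> \<Phi> \<subseteq> elems rs \<and>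
     (\<forall>B \<subseteq> \<Phi>. B \<noteq> {} \<longrightarrow> (wprec rs \<union> prec rs) \<inter> B \<times> (\<Phi> - B) = {} \<longrightarrow> B = \<Phi>)"
    (is "_ \<longleftrightarrow> _ \<and> _ \<and> ?nocut")
proof -
  define R where "R = (wprec rs \<union> prec rs) \<inter> \<Phi> \<times> \<Phi>"
  have csc: "csc_subset rs \<Phi> \<longleftrightarrow> \<Phi> \<noteq> {} \<and> \<Phi> \<subseteq> elems rs \<and>
      (\<forall>u\<in>\<Phi>. \<forall>v\<in>\<Phi>. (u, v) \<in> rtrancl_on \<Phi> R)"
    by (auto simp: csc_subset_def strongly_connected_def reachable_def R_def)
  have closed: "v \<in> B" if "(u, v) \<in> rtrancl_on \<Phi> R" "u \<in> B"
    "(wprec rs \<union> prec rs) \<inter> B \<times> (\<Phi> - B) = {}" for u v B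
    using that by (induction rule: rtrancl_on.induct) (auto simp: R_def)
  have "(\<forall>u\<in>\<Phi>. \<forall>v\<in>\<Phi>. (u, v) \<in> rtrancl_on \<Phi> R) \<longleftrightarrow> ?nocut"
  proof
    assume "\<forall>u\<in>\<Phi>. \<forall>v\<in>\<Phi>. (u, v) \<in> rtrancl_on \<Phi> R"
    then show ?nocut using closed by blast
  next
    assume nocut: ?nocut
    show "\<forall>u\<in>\<Phi>. \<forall>v\<in>\<Phi>. (u, v) \<in> rtrancl_on \<Phi> R"
    proof
      fix u assume u: "u \<in> \<Phi>"
      define B where "B = {v \<in> \<Phi>. (u, v) \<in> rtrancl_on \<Phi> R}"
      have "u \<in> B" using u by (simp add: B_def)
      moreover have "(wprec rs \<union> prec rs) \<inter> B \<times> (\<Phi> - B) = {}"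
        by (auto simp: B_def R_def intro: rtrancl_on_into_rtrancl_on)
      moreover have "B \<subseteq> \<Phi>" by (auto simp: B_def)
      ultimately have "B = \<Phi>" using nocut by blast
      then show "\<forall>v\<in>\<Phi>. (u, v) \<in> rtrancl_on \<Phi> R" by (auto simp: B_def)
    qed
  qed
  then show ?thesis unfolding csc by blast
qed

lemma csc_subset_pair:
  assumes "x \<in> elems rs" "y \<in> elems rs"
    "(x, y) \<in> wprec rs \<union> prec rs" "(y, x) \<in> wprec rs \<union> prec rs"
  shows "csc_subset rs {x, y}"
  unfolding csc_subset_iff_no_cut using assms by blast

section \<open>Maximal structures belong to \<open>QSAS\<close> and are maximal there\<close>

text \<open>Conditions (1)-(3) leave no freedom for \<open>wprec\<close> once \<open>prec\<close> is
  chosen, so constructing a member of \<open>QSMS\<close> amounts to finding a suitable order on the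
  carrier.\<close>

lemma QSMS_iff:
  "rs \<in> QSMS \<longleftrightarrow> is_structure rs \<and>
     wprec rs = {(x, y) \<in> elems rs \<times> elems rs. x \<noteq> y \<and> (y, x) \<notin> prec rs} \<and>
     quasi_stratified (prec rs)"
proof (intro iffI conjI)
  assume rs: "rs \<in> QSMS"
  then show st: "is_structure rs" by (simp add: QSMS_def)
  from st have sub: "prec rs \<subseteq> elems rs \<times> elems rs" "wprec rs \<subseteq> elems rs \<times> elems rs"
    by (auto simp: is_structure_def)
  have 1: "(x, x) \<notin> wprec rs"
    and 2: "(x, y) \<in> prec rs \<longleftrightarrow> (x, y) \<in> wprec rs \<and> (y, x) \<notin> wprec rs"
    and 3: "x \<noteq> y \<longleftrightarrow> (x, y) \<in> prec rs \<or> (y, x) \<in> prec rs \<or> (x, y) \<in> wprec rs \<and> (y, x) \<in> wprec rs"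
    if "x \<in> elems rs" "y \<in> elems rs" for x y
    using rs that unfolding QSMS_def by blast+
  show "wprec rs = {(x, y) \<in> elems rs \<times> elems rs. x \<noteq> y \<and> (y, x) \<notin> prec rs}"
  proof (rule set_eqI, clarify)
    fix x y
    show "(x, y) \<in> wprec rs \<longleftrightarrow>
        (x, y) \<in> {(x, y) \<in> elems rs \<times> elems rs. x \<noteq> y \<and> (y, x) \<notin> prec rs}"
    proof (cases "x \<in> elems rs \<and> y \<in> elems rs")
      case True
      then show ?thesis using 1[of x] 2[of x y] 2[of y x] 3[of x y] by auto
    qed (use sub in auto)
  qed
  have "asym (prec rs)" using 2 sub by (intro asymI) blast
  moreover have "(x, t) \<in> prec rs \<and> (z, y) \<in> prec rs \<or> (x, z) \<in> prec rs \<and> (x, t) \<in> prec rs \<or>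
      (z, x) \<in> prec rs \<and> (z, y) \<in> prec rs \<or> (t, y) \<in> prec rs \<and> (z, y) \<in> prec rs \<or>
      (y, t) \<in> prec rs \<and> (x, t) \<in> prec rs"
    if "(x, y) \<in> prec rs" "(z, t) \<in> prec rs" for x y z t
  proof -
    have e: "x \<in> elems rs" "y \<in> elems rs" "z \<in> elems rs" "t \<in> elems rs" using that sub by auto
    show ?thesis
      using rs[unfolded QSMS_def mem_Collect_eq, THEN conjunct2, rule_format, OF e] that by simp
  qed
  ultimately show "quasi_stratified (prec rs)" unfolding quasi_stratified_def by simp
next
  assume a: "is_structure rs \<and>
     wprec rs = {(x, y) \<in> elems rs \<times> elems rs. x \<noteq> y \<and> (y, x) \<notin> prec rs} \<and>
     quasi_stratified (prec rs)"
  then have w: "(x, y) \<in> wprec rs \<longleftrightarrow> x \<in> elems rs \<and> y \<in> elems rs \<and> x \<noteq> y \<and> (y, x) \<notin> prec rs" for x y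
    by auto
  have qs: "quasi_stratified (prec rs)" using a by blast
  show "rs \<in> QSMS"
    unfolding QSMS_def mem_Collect_eq
  proof (intro conjI ballI)
    show "is_structure rs" using a by blast
    fix x y z t
    assume e: "x \<in> elems rs" "y \<in> elems rs" "z \<in> elems rs" "t \<in> elems rs"
    show "(x, x) \<notin> wprec rs" by (simp add: w)
    show "((x, y) \<in> prec rs) = ((x, y) \<in> wprec rs \<and> (y, x) \<notin> wprec rs)"
      "(x \<noteq> y) = ((x, y) \<in> prec rs \<or> (y, x) \<in> prec rs \<or> (x, y) \<in> wprec rs \<and> (y, x) \<in> wprec rs)"
      using e quasi_stratified_asym[OF qs] by (auto simp: w)
  qed (use quasi_stratified_four_points[OF qs] in blast)
qed

lemma QSMS_subset_QSAS: "rs \<in> QSMS \<Longrightarrow> rs \<in> QSAS"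
proof -
  assume rs: "rs \<in> QSMS"
  then have st: "is_structure rs" and qs: "quasi_stratified (prec rs)"
    and w: "wprec rs = {(x, y) \<in> elems rs \<times> elems rs. x \<noteq> y \<and> (y, x) \<notin> prec rs}"
    by (auto simp: QSMS_iff)
  have "relational_structure rs"
    using st w quasi_stratified_asym[OF qs] by (auto simp: relational_structure_def irrefl_on_def)
  moreover have "\<exists>x. pre_dominant rs \<Phi> x" if \<Phi>: "csc_subset rs \<Phi>" for \<Phi>
  proof (rule ccontr)
    assume "\<nexists>x. pre_dominant rs \<Phi> x"
    then have ni: "\<forall>x\<in>\<Phi>. \<exists>y\<in>\<Phi>. (x, y) \<in> prec rs \<or> (y, x) \<in> prec rs"
      by (auto simp: pre_dominant_def)
    have "finite \<Phi>" "\<Phi> \<noteq> {}"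
      using \<Phi> st by (auto simp: csc_subset_def is_structure_def intro: finite_subset)
    from quasi_stratified_split[OF qs this ni] obtain B
      where B: "B \<subseteq> \<Phi>" "B \<noteq> {}" "B \<noteq> \<Phi>" "(\<Phi> - B) \<times> B \<subseteq> prec rs" .
    \<comment> \<open>Everything outside \<open>B\<close> lies below \<open>B\<close>, and neither
      relation reverses a pair of \<open>prec rs\<close>; hence no edge leaves
      \<open>B\<close>.\<close>
    then have "(wprec rs \<union> prec rs) \<inter> B \<times> (\<Phi> - B) = {}"
      using w quasi_stratified_asym[OF qs] by blast
    then show False using \<Phi> B unfolding csc_subset_iff_no_cut by blast
  qed
  ultimately show ?thesis by (simp add: QSAS_def)
qed

text \<open>A converse edge would make \<open>{x, y}\<close> a csc-subset whose points are both
  excluded as pre-dominants by \<open>(x, y)\<close>.\<close>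

lemma QSAS_prec_no_converse:
  assumes rs: "rs \<in> QSAS" and xy: "(x, y) \<in> prec rs"
  shows "(y, x) \<notin> wprec rs \<union> prec rs"
proof
  assume yx: "(y, x) \<in> wprec rs \<union> prec rs"
  have "x \<in> elems rs" "y \<in> elems rs"
    using rs xy by (auto simp: QSAS_def relational_structure_def is_structure_def)
  then have "csc_subset rs {x, y}" using xy yx by (intro csc_subset_pair) auto
  then show False using rs xy by (auto simp: QSAS_def pre_dominant_def)
qed

text \<open>A new pair in \<open>prec\<close> would reverse a pair already in
  \<open>wprec rs\<close>, and a new pair in \<open>wprec\<close> would reverse one already in
  \<open>prec rs\<close>. Neither can occur in \<open>QSAS\<close>.\<close>

lemma QSMS_maximal:
  assumes rs: "rs \<in> QSMS" and rs': "rs' \<in> QSAS" and ext: "extension_of rs' rs"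
  shows "rs' = rs"
proof -
  have w: "wprec rs = {(x, y) \<in> elems rs \<times> elems rs. x \<noteq> y \<and> (y, x) \<notin> prec rs}"
    using rs by (simp add: QSMS_iff)
  have sub: "elems rs = elems rs'" "prec rs \<subseteq> prec rs'" "wprec rs \<subseteq> wprec rs'"
    using ext by (auto simp: extension_of_def)
  have in': "prec rs' \<subseteq> elems rs' \<times> elems rs'" "wprec rs' \<subseteq> elems rs' \<times> elems rs'"
    and irr: "\<And>x. x \<in> elems rs' \<Longrightarrow> (x, x) \<notin> prec rs'"
      "\<And>x. x \<in> elems rs' \<Longrightarrow> (x, x) \<notin> wprec rs'"
    using rs' by (auto simp: QSAS_def relational_structure_def is_structure_def irrefl_on_def)
  note nc = QSAS_prec_no_converse[OF rs']
  have "prec rs' \<subseteq> prec rs"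
  proof clarify
    fix x y assume xy: "(x, y) \<in> prec rs'"
    then have "x \<noteq> y" "(y, x) \<notin> wprec rs" using in' irr nc sub by blast+
    then show "(x, y) \<in> prec rs" using xy in' sub by (auto simp: w)
  qed
  moreover have "wprec rs' \<subseteq> wprec rs"
    using in' irr nc sub by (auto simp: w)
  ultimately show ?thesis using sub by (intro structure_triple.equality) auto
qed

section \<open>Extending a structure in \<open>QSAS\<close> to one in \<open>QSMS\<close>\<close>

text \<open>The order is built recursively, removing a pre-dominant or cutting \<open>\<Phi>\<close>
  in two. The clause on \<open>P\<inverse>\<close> keeps \<open>wprec rs\<close> inside the weak
  relation that \<open>QSMS_iff\<close> will assign to \<open>P\<close>.\<close>

lemma QSAS_compatible_order:
  assumes rs: "rs \<in> QSAS" and "finite \<Phi>" "\<Phi> \<subseteq> elems rs"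
  shows "\<exists>P \<subseteq> \<Phi> \<times> \<Phi>. quasi_stratified P \<and> prec rs \<inter> \<Phi> \<times> \<Phi> \<subseteq> P \<and> wprec rs \<inter> P\<inverse> = {}"
  using assms(2,3)
proof (induction \<Phi> rule: finite_psubset_induct)
  case (psubset \<Phi>)
  consider "\<Phi> = {}" | "csc_subset rs \<Phi>"
    | B where "B \<subseteq> \<Phi>" "B \<noteq> {}" "B \<noteq> \<Phi>" "(wprec rs \<union> prec rs) \<inter> B \<times> (\<Phi> - B) = {}"
    using psubset.prems unfolding csc_subset_iff_no_cut by blast
  then show ?case
  proof cases
    case 1
    then show ?thesis using quasi_stratified_empty by auto
  next
    case 2
    then obtain x where x: "pre_dominant rs \<Phi> x" using rs by (auto simp: QSAS_def)
    then have "\<Phi> - {x} \<subset> \<Phi>" by (auto simp: pre_dominant_def)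
    from psubset.IH[OF this] psubset.prems obtain P
      where "P \<subseteq> (\<Phi> - {x}) \<times> (\<Phi> - {x})" "quasi_stratified P"
        "prec rs \<inter> (\<Phi> - {x}) \<times> (\<Phi> - {x}) \<subseteq> P" "wprec rs \<inter> P\<inverse> = {}" by blast
    \<comment> \<open>No pair of \<open>prec rs\<close> within \<open>\<Phi>\<close> involves
      \<open>x\<close>, so the order on the remaining points serves unchanged, with \<open>x\<close>
      isolated.\<close>
    then show ?thesis using x unfolding pre_dominant_def by (intro exI[of _ P]) blast
  next
    case 3
    \<comment> \<open>All edges between the two sides run from \<open>A\<close> to \<open>B\<close>,
      so placing \<open>A\<close> entirely below \<open>B\<close> reverses none of them.\<close>
    define A where "A = \<Phi> - B"
    have "A \<subset> \<Phi>" "B \<subset> \<Phi>" using 3 by (auto simp: A_def)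
    obtain P where P: "P \<subseteq> A \<times> A" "quasi_stratified P" "prec rs \<inter> A \<times> A \<subseteq> P"
        "wprec rs \<inter> P\<inverse> = {}"
      using psubset.IH[OF \<open>A \<subset> \<Phi>\<close>] \<open>A \<subset> \<Phi>\<close> psubset.prems by blast
    obtain Q where Q: "Q \<subseteq> B \<times> B" "quasi_stratified Q" "prec rs \<inter> B \<times> B \<subseteq> Q"
        "wprec rs \<inter> Q\<inverse> = {}"
      using psubset.IH[OF \<open>B \<subset> \<Phi>\<close>] \<open>B \<subset> \<Phi>\<close> psubset.prems by blast
    have "quasi_stratified (P \<union> Q \<union> A \<times> B)"
      using P Q by (intro quasi_stratified_series) (auto simp: A_def)
    moreover have "P \<union> Q \<union> A \<times> B \<subseteq> \<Phi> \<times> \<Phi>" using P Q 3 by (auto simp: A_def)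
    moreover have "prec rs \<inter> \<Phi> \<times> \<Phi> \<subseteq> P \<union> Q \<union> A \<times> B"
      using P(3) Q(3) 3(4) unfolding A_def by blast
    moreover have "wprec rs \<inter> (P \<union> Q \<union> A \<times> B)\<inverse> = {}"
      using P(4) Q(4) 3(4) unfolding A_def by blast
    ultimately show ?thesis by blast
  qed
qed

lemma QSAS_extends_to_QSMS:
  assumes rs: "rs \<in> QSAS"
  obtains rs' where "rs' \<in> QSMS" "extension_of rs' rs"
proof -
  have st: "finite (elems rs)" "prec rs \<subseteq> elems rs \<times> elems rs" "wprec rs \<subseteq> elems rs \<times> elems rs"
    and irr: "\<And>x. x \<in> elems rs \<Longrightarrow> (x, x) \<notin> wprec rs"
    using rs by (auto simp: QSAS_def relational_structure_def is_structure_def irrefl_on_def)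
  obtain P where P: "P \<subseteq> elems rs \<times> elems rs" "quasi_stratified P"
      "prec rs \<inter> elems rs \<times> elems rs \<subseteq> P" "wprec rs \<inter> P\<inverse> = {}"
    using QSAS_compatible_order[OF rs st(1)] by blast
  \<comment> \<open>This \<open>wprec\<close> is forced by \<open>QSMS_iff\<close>. It contains
    \<open>wprec rs\<close>, which is irreflexive and reverses no pair of \<open>P\<close>.\<close>
  define rs' where "rs' = \<lparr>elems = elems rs, prec = P,
    wprec = {(x, y) \<in> elems rs \<times> elems rs. x \<noteq> y \<and> (y, x) \<notin> P}\<rparr>"
  show thesis
  proof
    show "rs' \<in> QSMS"
      using P st(1) by (auto simp: QSMS_iff rs'_def is_structure_def)
    show "extension_of rs' rs"
      using P st irr by (auto simp: extension_of_def rs'_def)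
  qed
qed

theorem theorem6p4:
  shows "(QSMS :: 'a structure_triple set) = QSAS_max"
proof
  show "(QSMS :: 'a structure_triple set) \<subseteq> QSAS_max"
    using QSMS_subset_QSAS QSMS_maximal by (auto simp: QSAS_max_def)
  show "(QSAS_max :: 'a structure_triple set) \<subseteq> QSMS"
  proof
    fix rs :: "'a structure_triple"
    assume rs: "rs \<in> QSAS_max"
    then obtain rs' where "rs' \<in> QSMS" "extension_of rs' rs"
      using QSAS_extends_to_QSMS by (auto simp: QSAS_max_def)
    \<comment> \<open>Since \<open>rs'\<close> also lies in \<open>QSAS\<close>, maximality of
      \<open>rs\<close> gives \<open>rs' = rs\<close>.\<close>
    with rs show "rs \<in> QSMS"
      using QSMS_subset_QSAS by (auto simp: QSAS_max_def)
  qed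
qed

end
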